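(* Let $D=(V,A)$ be a tournament. For each $\sigma\in\mathfrak{S}_V$ let $\psi(\sigma)$ denote the number of nontrivial cycles of $\sigma$. Then \[U_D=\sum_{\substack{\sigma\in\mathfrak{S}_V(D);\\ \text{all cycles of }\sigma\text{ have odd length}}}2^{\psi(\sigma)}\,p_{\operatorname{type}\sigma}.\]
   Context: A tournament is a digraph $D=(V,A)$ ($V$ finite, $A\subseteq V\times V$) with $(u,u)\notin A$ for all $u$ and such that for any two distinct $u,v\in V$ exactly one of $(u,v),(v,u)$ lies in $A$. Let $n=|V|$. A $V$-listing is a tuple $w=(w_1,\dots,w_n)$ containing each element of $V$ exactly once; $\operatorname{Des}(w,D)=\{i\in[n-1]:(w_i,w_{i+1})\in A\}$; $L_{I,n}=\sum x_{i_1}\cdots x_{i_n}$ over positive integers $i_1\le\cdots\le i_n$ with $i_p<i_{p+1}$ for $p\in I$; $U_D=\sum_w L_{\operatorname{Des}(w,D),n}$ over all $V$-listings. Cycles of $\sigma\in\mathfrak{S}_V$ are the rotation-equivalence classes of tuples $(i,\sigma(i),\dots,\sigma^{k-1}(i))$ with $k$ minimal such that $\sigma^k(i)=i$; a cycle is nontrivial if its length exceeds $1$. For the class $\gamma$ of $(v_1,\dots,v_k)$, $\operatorname{CArcs}\gamma=\{(v_1,v_2),\dots,(v_{k-1},v_k),(v_k,v_1)\}$; a $D$-cycle is a rotation-equivalence class $\gamma$ of nonempty tuples of distinct vertices with $\operatorname{CArcs}\gamma\subseteq A$. $\mathfrak{S}_V(D)$ is the set of $\sigma\in\mathfrak{S}_V$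 each of whose nontrivial cycles is a $D$-cycle. $\operatorname{type}\sigma$ is the partition of cycle lengths; $p_k=\sum_i x_i^k$, $p_\lambda=\prod_j p_{\lambda_j}$. *)

theory Defs
  imports "HOL-Combinatorics.Cycles" "HOL-Combinatorics.Multiset_Permutations"
begin

text \<open>
  Series in the variables \<open>x\<^sub>0, x\<^sub>1, x\<^sub>2, \<dots>\<close>: a monomial is the multiset of the indices of its variables (with multiplicity), and a formal
  power series is an arbitrary family of coefficients indexed by the monomials. The variable
  \<open>x\<^sub>0\<close> exists in this ring but occurs in none of the series defined below.
\<close>

typedef 'a mfps = "UNIV :: (nat multiset \<Rightarrow> 'a) set"
  morphisms mcoeff Abs_mfps ..

setup_lifting type_definition_mfps

lemma mfps_eq_iff: "f = g \<longleftrightarrow> (\<forall>m. mcoeff f m = mcoeff g m)"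
  by transfer auto

lemma mfps_eqI: "(\<And>m. mcoeff f m = mcoeff g m) \<Longrightarrow> f = g"
  by (simp add: mfps_eq_iff)

lemma finite_subset_mset: "finite {a. a \<subseteq># (m :: 'b multiset)}"
proof (induction m)
  case empty
  then show ?case by simp
next
  case (add x m)
  have "{a. a \<subseteq># add_mset x m} \<subseteq> {a. a \<subseteq># m} \<union> add_mset x ` {a. a \<subseteq># m}"
  proof
    fix a assume "a \<in> {a. a \<subseteq># add_mset x m}"
    then have a: "a \<subseteq># add_mset x m" by simp
    show "a \<in> {a. a \<subseteq># m} \<union> add_mset x ` {a. a \<subseteq># m}"
    proof (cases "x \<in># a")
      case True
      then obtain b where "a = add_mset x b" by (metis insert_DiffM)
      with a show ?thesis by auto
    next
      case False
      with a have "a \<subseteq># m"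
        by (metis diff_single_trivial subset_eq_diff_conv add_mset_add_single)
      then show ?thesis by simp
    qed
  qed
  then show ?case using add.IH by (meson finite_UnI finite_imageI finite_subset)
qed

lemma finite_mset_splits: "finite {(a, b). a + b = (m :: 'b multiset)}"
  by (rule finite_subset[of _ "{a. a \<subseteq># m} \<times> {a. a \<subseteq># m}"])
     (auto simp: finite_subset_mset)

instantiation mfps :: (comm_ring_1) comm_ring_1
begin

lift_definition zero_mfps :: "'a mfps" is "\<lambda>_. 0" .
lift_definition one_mfps :: "'a mfps" is "\<lambda>m. if m = {#} then 1 else 0" .
lift_definition plus_mfps :: "'a mfps \<Rightarrow> 'a mfps \<Rightarrow> 'a mfps" is "\<lambda>f g m. f m + g m" .
lift_definition minus_mfps :: "'a mfps \<Rightarrow> 'a mfps \<Rightarrow> 'a mfps" is "\<lambda>f g m. f m - g m" .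
lift_definition uminus_mfps :: "'a mfps \<Rightarrow> 'a mfps" is "\<lambda>f m. - f m" .
lift_definition times_mfps :: "'a mfps \<Rightarrow> 'a mfps \<Rightarrow> 'a mfps"
  is "\<lambda>f g m. \<Sum>(a, b) | a + b = m. f a * g b" .

instance
proof
  fix f g h :: "'a mfps"
  show "f + g + h = f + (g + h)" by transfer (simp add: add.assoc)
  show "f + g = g + f" by transfer (simp add: add.commute)
  show "0 + f = f" by transfer simp
  show "- f + f = 0" by transfer simp
  show "f - g = f + - g" by transfer simp
  show "(0 :: 'a mfps) \<noteq> 1" by transfer (auto dest: fun_cong[of _ _ "{#}"])
  show "(f + g) * h = f * h + g * h"
    by transfer (simp add: distrib_right sum.distrib case_prod_unfold)
  show "f * g = g * f"
  proof (transfer, rule ext)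
    fix f g :: "nat multiset \<Rightarrow> 'a" and m
    show "(\<Sum>(a, b) | a + b = m. f a * g b) = (\<Sum>(a, b) | a + b = m. g a * f b)"
      by (rule sum.reindex_bij_witness[of _ prod.swap prod.swap])
         (auto simp: add.commute mult.commute)
  qed
  show "1 * f = f"
  proof (transfer, rule ext)
    fix f :: "nat multiset \<Rightarrow> 'a" and m
    have "(\<Sum>(a, b) | a + b = m. (if a = {#} then 1 else 0) * f b)
        = (\<Sum>(a, b) \<in> {({#} :: nat multiset, m)}. (if a = {#} then 1 else 0) * f b)"
      by (rule sum.mono_neutral_right) (auto simp: finite_mset_splits split: if_splits)
    then show "(\<Sum>(a, b) | a + b = m. (if a = {#} then 1 else 0) * f b) = f m" by simp
  qed
  show "f * g * h = f * (g * h)"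
  proof (transfer, rule ext)
    fix f g h :: "nat multiset \<Rightarrow> 'a" and m
    let ?S = "\<lambda>m :: nat multiset. {(a, b). a + b = m}"
    have "(\<Sum>(a, b) \<in> ?S m. (\<Sum>(c, d) \<in> ?S a. f c * g d) * h b)
        = (\<Sum>p \<in> ?S m. \<Sum>q \<in> ?S (fst p). f (fst q) * g (snd q) * h (snd p))"
      by (simp add: case_prod_unfold sum_distrib_right)
    also have "\<dots> = (\<Sum>(p, q) \<in> Sigma (?S m) (\<lambda>p. ?S (fst p)). f (fst q) * g (snd q) * h (snd p))"
      by (rule sum.Sigma) (use finite_mset_splits in blast)+
    also have "\<dots> = (\<Sum>(p, q) \<in> Sigma (?S m) (\<lambda>p. ?S (snd p)). f (fst p) * (g (fst q) * h (snd q)))"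
      by (rule sum.reindex_bij_witness
            [of _ "\<lambda>(p, q). ((fst p + fst q, snd q), (fst p, fst q))"
                  "\<lambda>(p, q). ((fst q, snd q + snd p), (snd q, snd p))"])
         (auto simp: add.assoc mult.assoc)
    also have "\<dots> = (\<Sum>p \<in> ?S m. \<Sum>q \<in> ?S (snd p). f (fst p) * (g (fst q) * h (snd q)))"
      by (rule sum.Sigma[symmetric]) (use finite_mset_splits in blast)+
    also have "\<dots> = (\<Sum>(a, b) \<in> ?S m. f a * (\<Sum>(c, d) \<in> ?S b. g c * h d))"
      by (simp add: case_prod_unfold sum_distrib_left)
    finally show "(\<Sum>(a, b) \<in> ?S m. (\<Sum>(c, d) \<in> ?S a. f c * g d) * h b)
        = (\<Sum>(a, b) \<in> ?S m. f a * (\<Sum>(c, d) \<in> ?S b. g c * h d))" .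
  qed
qed

end

lift_definition mvar :: "nat \<Rightarrow> 'a::comm_ring_1 mfps"
  is "\<lambda>i m. if m = {#i#} then 1 else 0" .

text \<open>
  The sum of a possibly infinite family, taken coefficientwise. It is meaningful for families in
  which every monomial has a nonzero coefficient in only finitely many members.
\<close>

lift_definition formal_sum :: "('b \<Rightarrow> 'a::comm_ring_1 mfps) \<Rightarrow> 'b set \<Rightarrow> 'a mfps"
  is "\<lambda>f I m. \<Sum>i | i \<in> I \<and> f i m \<noteq> 0. f i m" .

definition formally_summable :: "('b \<Rightarrow> 'a::comm_ring_1 mfps) \<Rightarrow> 'b set \<Rightarrow> bool" where
  "formally_summable f I \<longleftrightarrow> (\<forall>m. finite {i \<in> I. mcoeff (f i) m \<noteq> 0})"

definition power_sum :: "nat \<Rightarrow> int mfps" where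
  "power_sum k = formal_sum (\<lambda>i. mvar i ^ k) {1..}"

text \<open>Partitions are represented by the multisets of their parts.\<close>

definition power_sum_partition :: "nat multiset \<Rightarrow> int mfps" where
  "power_sum_partition la = (\<Prod>k \<in># la. power_sum k)"

text \<open>
  The tuple \<open>(i\<^sub>1, \<dots>, i\<^sub>n)\<close> is the list \<open>is\<close> with \<open>i\<^sub>p = is ! (p - 1)\<close>; the set \<open>I\<close> is meant to
  be a subset of \<open>{1..n - 1}\<close>.
\<close>

definition fundamental_tuples :: "nat set \<Rightarrow> nat \<Rightarrow> nat list set" where
  "fundamental_tuples I n =
     {is. length is = n \<and> (\<forall>i \<in> set is. i \<ge> 1) \<and> sorted is \<and> (\<forall>p \<in> I. is ! (p - 1) < is ! p)}"

definition fundamental_qsym :: "nat set \<Rightarrow> nat \<Rightarrow> int mfps" where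
  "fundamental_qsym I n = formal_sum (\<lambda>is. prod_list (map mvar is)) (fundamental_tuples I n)"

lemma mcoeff_monomial:
  "mcoeff (prod_list (map mvar is)) m = (if m = mset is then 1 else (0 :: 'a::comm_ring_1))"
proof (induction "is" arbitrary: m)
  case Nil
  show ?case by (simp add: one_mfps.rep_eq)
next
  case (Cons i "is")
  have "mcoeff (prod_list (map mvar (i # is))) m
      = (\<Sum>(a, b) | a + b = m. (if a = {#i#} then 1 else 0) * (if b = mset is then 1 else (0 :: 'a)))"
    by (simp add: times_mfps.rep_eq mvar.rep_eq Cons.IH)
  also have "\<dots> = (\<Sum>(a, b) \<in> {(a, b). a + b = m} \<inter> {({#i#}, mset is)}. 1)"
    by (rule sum.mono_neutral_cong_right) (auto simp: finite_mset_splits split: if_splits)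
  also have "\<dots> = (if m = mset (i # is) then 1 else 0)"
    by (cases "m = mset (i # is)") (simp_all add: Int_insert_right)
  finally show ?case .
qed

lemma mcoeff_mvar_power:
  "mcoeff (mvar i ^ k) m = (if m = replicate_mset k i then 1 else (0 :: 'a::comm_ring_1))"
  using mcoeff_monomial[of "replicate k i" m] by (simp add: prod_list_replicate)

lemma formally_summable_power_sum:
  assumes "k \<ge> 1"
  shows "formally_summable (\<lambda>i. mvar i ^ k :: int mfps) {1..}"
  unfolding formally_summable_def
proof
  fix m :: "nat multiset"
  have "{i \<in> {1..}. mcoeff (mvar i ^ k :: int mfps) m \<noteq> 0} \<subseteq> set_mset m"
    using assms by (auto simp: mcoeff_mvar_power split: if_splits)
  then show "finite {i \<in> {1..}. mcoeff (mvar i ^ k :: int mfps) m \<noteq> 0}"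
    by (rule finite_subset) simp
qed

lemma formally_summable_fundamental:
  "formally_summable (\<lambda>is. prod_list (map mvar is) :: int mfps) (fundamental_tuples I n)"
  unfolding formally_summable_def
proof
  fix m :: "nat multiset"
  let ?X = "{is \<in> fundamental_tuples I n. mcoeff (prod_list (map mvar is) :: int mfps) m \<noteq> 0}"
  have "?X \<subseteq> {xs. set xs \<subseteq> set_mset m \<and> length xs = n}"
    by (auto simp: mcoeff_monomial fundamental_tuples_def split: if_splits)
  then show "finite ?X"
    by (rule finite_subset) (simp add: finite_lists_length_eq)
qed

definition tournament :: "'v set \<Rightarrow> ('v \<times> 'v) set \<Rightarrow> bool" where
  "tournament V A \<longleftrightarrow>
     finite V \<and> A \<subseteq> V \<times> V \<and> (\<forall>u \<in> V. (u, u) \<notin> A) \<and>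
     (\<forall>u \<in> V. \<forall>v \<in> V. u \<noteq> v \<longrightarrow> ((u, v) \<in> A \<and> (v, u) \<notin> A) \<or> ((u, v) \<notin> A \<and> (v, u) \<in> A))"

definition Des :: "'v list \<Rightarrow> ('v \<times> 'v) set \<Rightarrow> nat set" where
  "Des w A = {i \<in> {1..length w - 1}. (w ! (i - 1), w ! i) \<in> A}"

definition redei_berge :: "'v set \<Rightarrow> ('v \<times> 'v) set \<Rightarrow> int mfps" where
  "redei_berge V A = (\<Sum>w \<in> permutations_of_set V. fundamental_qsym (Des w A) (card V))"

definition rot_class :: "'v list \<Rightarrow> 'v list set" where
  "rot_class vs = {rotate k vs | k. True}"

definition cycle_length :: "'v list set \<Rightarrow> nat" where
  "cycle_length \<gamma> = (THE k. \<forall>vs \<in> \<gamma>. length vs = k)"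

definition CArcs :: "'v list set \<Rightarrow> ('v \<times> 'v) set" where
  "CArcs \<gamma> = (\<Union>vs \<in> \<gamma>. set (zip vs (rotate1 vs)))"

lemma rot_class_self: "vs \<in> rot_class vs"
  unfolding rot_class_def by (auto intro: exI[of _ 0])

lemma cycle_length_rot_class [simp]: "cycle_length (rot_class vs) = length vs"
  unfolding cycle_length_def
proof (rule the_equality)
  show "\<forall>us \<in> rot_class vs. length us = length vs"
    by (auto simp: rot_class_def)
  show "k = length vs" if "\<forall>us \<in> rot_class vs. length us = k" for k
    using that rot_class_self[of vs] by auto
qed

lemma zip_rotate1:
  assumes "length xs = length ys"
  shows "zip (rotate1 xs) (rotate1 ys) = rotate1 (zip xs ys)"
  using assms by (cases xs; cases ys) auto

text \<open>The union in the definition of \<open>CArcs\<close> is over equal sets.\<close>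

lemma CArcs_rot_class: "CArcs (rot_class vs) = set (zip vs (rotate1 vs))"
proof -
  have "set (zip (rotate k vs) (rotate1 (rotate k vs))) = set (zip vs (rotate1 vs))" for k
  proof (induction k)
    case (Suc k)
    then show ?case by (simp add: zip_rotate1)
  qed simp
  then show ?thesis
    by (auto simp: CArcs_def rot_class_def)
qed

definition D_cycles :: "'v set \<Rightarrow> ('v \<times> 'v) set \<Rightarrow> 'v list set set" where
  "D_cycles V A =
     {rot_class vs | vs. vs \<noteq> [] \<and> distinct vs \<and> set vs \<subseteq> V \<and> CArcs (rot_class vs) \<subseteq> A}"

text \<open>
  The tuple \<open>support \<sigma> i\<close> is \<open>(i, \<sigma> i, \<dots>, \<sigma>\<^sup>k\<^sup>-\<^sup>1 i)\<close> with the least \<open>k > 0\<close> such that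
  \<open>\<sigma>\<^sup>k i = i\<close>; fixed points in \<open>V\<close> give cycles of length 1.
\<close>

definition cycles :: "'v set \<Rightarrow> ('v \<Rightarrow> 'v) \<Rightarrow> 'v list set set" where
  "cycles V \<sigma> = {rot_class (support \<sigma> i) | i. i \<in> V}"

definition nontrivial_cycles :: "'v set \<Rightarrow> ('v \<Rightarrow> 'v) \<Rightarrow> 'v list set set" where
  "nontrivial_cycles V \<sigma> = {\<gamma> \<in> cycles V \<sigma>. cycle_length \<gamma> > 1}"

definition D_perms :: "'v set \<Rightarrow> ('v \<times> 'v) set \<Rightarrow> ('v \<Rightarrow> 'v) set" where
  "D_perms V A = {\<sigma>. \<sigma> permutes V \<and> nontrivial_cycles V \<sigma> \<subseteq> D_cycles V A}"

definition cycle_type :: "'v set \<Rightarrow> ('v \<Rightarrow> 'v) \<Rightarrow> nat multiset" where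
  "cycle_type V \<sigma> = image_mset cycle_length (mset_set (cycles V \<sigma>))"

end

theory Submission
  imports Defs "HOL-Library.FuncSet"
begin

text \<open>
  A pair of a \<open>V\<close>-listing \<open>w\<close> and an admissible tuple \<open>i\<close> amounts to a colouring \<open>f\<close> of \<open>V\<close> (the entry
  \<open>w\<^sub>p\<close> gets the colour \<open>i\<^sub>p\<close>) and a listing without consecutive arcs of the digraph
  \<open>D\<^sub>f = {(x, y). f x > f y \<or> f x = f y \<and> (x, y) \<in> A}\<close>. The digraph \<open>D\<^sub>f\<close> is again a tournament, and its
  cycles are the \<open>D\<close>-cycles on which \<open>f\<close> is constant. So everything reduces to counting the
  listings of a tournament without consecutive arcs.

  For a weight function \<open>b = 1 + a\<close> on pairs, write \<open>b(w)\<close> for the product of the weights of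
  consecutive pairs of \<open>w\<close>. Fix \<open>v \<in> V\<close>. Expanding \<open>b(v r') = \<Sum> a(v x) b(r)\<close> over all splittings
  \<open>r' = x r\<close> turns the total weight of the listings \<open>t v r'\<close> of \<open>V\<close> into \<open>\<Sum> b(t v) a(v x) b(r)\<close>. Summing
  first over the splittings of \<open>y = x t\<close> telescopes to \<open>(b(v y v) - a(v y v)) b(r)\<close>. Hence the total
  weight satisfies a recursion that removes the cycle \<open>(v, y)\<close>. For a tournament, reversing the
  cycle matches the two terms up to the sign \<open>(-1)\<close> to the length, which leaves \<open>2\<close> for
  every odd nontrivial \<open>D\<close>-cycle and \<open>0\<close> for the even ones. The sum over permutations on the other
  side satisfies the same recursion.
\<close>

section \<open>Listings and cycles through a vertex\<close>

fun path_weight :: "('v \<Rightarrow> 'v \<Rightarrow> 'a) \<Rightarrow> 'v list \<Rightarrow> 'a::comm_ring_1" where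
  "path_weight b [] = 1"
| "path_weight b [x] = 1"
| "path_weight b (x # y # zs) = b x y * path_weight b (y # zs)"

definition listings_weight :: "('v \<Rightarrow> 'v \<Rightarrow> 'a) \<Rightarrow> 'v set \<Rightarrow> 'a::comm_ring_1" where
  "listings_weight b V = (\<Sum>w \<in> permutations_of_set V. path_weight b w)"

text \<open>The tuples \<open>y\<close> for which \<open>v # y\<close> is the cycle through \<open>v\<close> of a permutation of \<open>V\<close>.\<close>

definition cycle_tails :: "'v set \<Rightarrow> 'v \<Rightarrow> 'v list set" where
  "cycle_tails V v = {y. distinct (v # y) \<and> set y \<subseteq> V}"

lemma finite_cycle_tails: "finite V \<Longrightarrow> finite (cycle_tails V v)"
  by (rule finite_subset[OF _ finite_subset_distinct[of V]]) (auto simp: cycle_tails_def)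

text \<open>Cutting at \<open>v\<close> shares the vertex, not a pair: the step into
  \<open>v\<close> goes to the left factor, the step out of it to the right one.\<close>

lemma path_weight_append_Cons:
  "path_weight b (t @ v # r) = path_weight b (t @ [v]) * path_weight b (v # r)"
proof (induction t)
  case (Cons x t)
  then show ?case by (cases t) (simp_all add: mult.assoc)
qed simp

text \<open>Expand the factors \<open>1 + a\<close> from the left as long as the summand
  \<open>a\<close> is chosen. After \<open>j\<close> such choices the next factor contributes
  \<open>1\<close> and cuts the path; \<open>j = length r\<close> means that no cut occurs.\<close>

lemma path_weight_Cons_split:
  "path_weight (\<lambda>x y. 1 + a x y) (v # r) =
    (\<Sum>j\<le>length r. path_weight a (v # take j r) * path_weight (\<lambda>x y. 1 + a x y) (drop j r))"
proof (induction r arbitrary: v)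
  case (Cons u r)
  let ?b = "\<lambda>x y. 1 + a x y"
  have "path_weight ?b (v # u # r) = path_weight ?b (u # r) + a v u * path_weight ?b (u # r)"
    by (simp add: algebra_simps)
  also have "a v u * path_weight ?b (u # r)
      = (\<Sum>j\<le>length r. path_weight a (v # u # take j r) * path_weight ?b (drop j r))"
    by (subst Cons.IH) (simp add: sum_distrib_left mult.assoc)
  finally show ?case
    by (simp add: sum.atMost_Suc_shift del: sum.atMost_Suc)
qed simp

text \<open>The splitting of the path \<open>v # y @ [v]\<close>, with the uncut term moved to the
  left. In the remaining terms the cut comes before the final \<open>v\<close>.\<close>

lemma closed_path_weight_diff:
  "path_weight (\<lambda>x y. 1 + a x y) (v # y @ [v]) - path_weight a (v # y @ [v]) =
    (\<Sum>j\<le>length y. path_weight a (v # take j y) * path_weight (\<lambda>x y. 1 + a x y) (drop j y @ [v]))"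
  by (subst path_weight_Cons_split) simp

lemma listings_weight_recursion:
  fixes a :: "'v \<Rightarrow> 'v \<Rightarrow> 'a::comm_ring_1"
  defines "b \<equiv> \<lambda>x y. 1 + a x y"
  assumes V: "finite V" "v \<in> V"
  shows "listings_weight b V =
    (\<Sum>y \<in> cycle_tails V v. (path_weight b (v # y @ [v]) - path_weight a (v # y @ [v])) *
       listings_weight b (V - set (v # y)))"
proof -
  \<comment> \<open>\<open>T\<close> holds the listings of \<open>V\<close> cut at \<open>v\<close>;
    \<open>R\<close> holds the cycles through \<open>v\<close> together with a listing of the
    vertices that are left.\<close>
  define T where "T = {(t, r). t @ v # r \<in> permutations_of_set V}"
  define R where "R = Sigma (cycle_tails V v) (\<lambda>y. permutations_of_set (V - set (v # y)))"
  have inj_T: "inj_on (\<lambda>(t, r). t @ v # r) T"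
  proof (rule inj_onI)
    fix p p' assume p: "p \<in> T" "p' \<in> T" "(case p of (t, r) \<Rightarrow> t @ v # r) = (case p' of (t, r) \<Rightarrow> t @ v # r)"
    obtain t r t' r' where pp: "p = (t, r)" "p' = (t', r')" by (cases p, cases p')
    with p have A: "t @ v # r \<in> permutations_of_set V" "t @ v # r = t' @ v # r'"
      by (auto simp: T_def)
    then have "distinct (t @ v # r)" by (simp add: permutations_of_set_def)
    then have "v \<notin> set t" "v \<notin> set r" by auto
    with A(2) show "p = p'"
      using append_Cons_eq_iff[of v t r t' r'] pp by simp
  qed
  have img_T: "(\<lambda>(t, r). t @ v # r) ` T = permutations_of_set V"
  proof -
    have "\<exists>t r. w = t @ v # r" if "w \<in> permutations_of_set V" for w
      using that V split_list[of v w] by (auto simp: permutations_of_set_def)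
    then show ?thesis by (fastforce simp: T_def image_iff)
  qed
  have fin_T: "finite T"
    using finite_imageD[OF _ inj_T] by (simp add: img_T)
  have "listings_weight b V = (\<Sum>(t, r)\<in>T. path_weight b (t @ v # r))"
    unfolding listings_weight_def img_T[symmetric]
    by (subst sum.reindex[OF inj_T]) (simp add: case_prod_unfold)
  also have "\<dots> = (\<Sum>p\<in>T. \<Sum>j\<le>length (snd p). path_weight b (fst p @ [v]) *
      (path_weight a (v # take j (snd p)) * path_weight b (drop j (snd p))))"
    by (subst path_weight_append_Cons)
       (simp add: b_def path_weight_Cons_split sum_distrib_left case_prod_unfold)
  also have "\<dots> = (\<Sum>(p, j)\<in>Sigma T (\<lambda>p. {..length (snd p)}). path_weight b (fst p @ [v]) *
      (path_weight a (v # take j (snd p)) * path_weight b (drop j (snd p))))"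
    by (rule sum.Sigma) (use fin_T in auto)
  \<comment> \<open>The first \<open>j\<close> entries of \<open>r\<close> are moved in front of
    \<open>t\<close> to form the cycle tail. Keeping \<open>j\<close> makes this invertible, since
    it tells where to cut the tail again.\<close>
  also have "\<dots> = (\<Sum>(q, j)\<in>Sigma R (\<lambda>q. {..length (fst q)}).
      path_weight a (v # take j (fst q)) * path_weight b (drop j (fst q) @ [v]) * path_weight b (snd q))"
  proof (rule sum.reindex_bij_witness[of _ "\<lambda>((y, r), j). ((drop j y, take j y @ r), j)"
          "\<lambda>((t, r), j). ((take j r @ t, drop j r), j)"], goal_cases)
    case (2 p)
    then obtain t r j where p: "p = ((t, r), j)" "t @ v # r \<in> permutations_of_set V" "j \<le> length r"
      by (auto simp: T_def)
    obtain x z where "r = x @ z" "j = length x"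
      using p(3) by (metis append_take_drop_id length_take min_absorb2)
    then show ?case using p
      by (auto simp: R_def cycle_tails_def permutations_of_set_def)
  next
    case (4 p)
    then obtain y r j where p: "p = ((y, r), j)" "y \<in> cycle_tails V v"
        "r \<in> permutations_of_set (V - set (v # y))" "j \<le> length y"
      by (auto simp: R_def)
    obtain x z where "y = x @ z" "j = length x"
      using p(4) by (metis append_take_drop_id length_take min_absorb2)
    then show ?case using p V
      by (auto simp: T_def cycle_tails_def permutations_of_set_def)
  qed (auto simp: R_def T_def mult_ac)
  also have "\<dots> = (\<Sum>q\<in>R. \<Sum>j\<le>length (fst q).
      path_weight a (v # take j (fst q)) * path_weight b (drop j (fst q) @ [v]) * path_weight b (snd q))"
    by (rule sum.Sigma[symmetric]) (use V in \<open>auto simp: R_def finite_cycle_tails\<close>)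
  \<comment> \<open>For a fixed cycle and remainder, the sum over all cutting places is the one in
    \<open>closed_path_weight_diff\<close>.\<close>
  also have "\<dots> = (\<Sum>(y, r)\<in>R. (path_weight b (v # y @ [v]) - path_weight a (v # y @ [v])) * path_weight b r)"
    unfolding b_def closed_path_weight_diff by (simp add: case_prod_unfold sum_distrib_right)
  also have "\<dots> = (\<Sum>y \<in> cycle_tails V v. (path_weight b (v # y @ [v]) - path_weight a (v # y @ [v])) *
       listings_weight b (V - set (v # y)))"
    unfolding R_def listings_weight_def sum_distrib_left
    by (rule sum.Sigma[symmetric]) (use V in \<open>auto simp: finite_cycle_tails\<close>)
  finally show ?thesis .
qed

section \<open>Listings of a tournament without consecutive arcs\<close>

lemma path_weight_of_bool:
  "path_weight (\<lambda>x y. of_bool (P x y)) w = of_bool (successively P w)"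
  by (induction w rule: induct_list012) auto

lemma path_weight_uminus:
  "path_weight (\<lambda>x y. - b x y) w = (-1) ^ (length w - 1) * path_weight b w"
  by (induction w rule: induct_list012) auto

definition avoiding_listings :: "'v set \<Rightarrow> ('v \<times> 'v) set \<Rightarrow> int" where
  "avoiding_listings V A = int (card {w \<in> permutations_of_set V. successively (\<lambda>x y. (x, y) \<notin> A) w})"

text \<open>The coefficient of a removed cycle. A single vertex is a separate case: it has no loop,
  yet it must count \<open>1\<close>.\<close>

definition tour_weight :: "('v \<times> 'v) set \<Rightarrow> 'v list \<Rightarrow> int" where
  "tour_weight A s = (if length s = 1 then 1
     else if odd (length s) \<and> successively (\<lambda>x y. (x, y) \<in> A) (s @ [hd s]) then 2 else 0)"

text \<open>In a tournament a closed walk on at least two distinct vertices follows arcs iff its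
  reversal avoids them. Reversing the tails in the \<open>b\<close>-part of the recursion therefore
  leaves the coefficient \<open>1 - (-1)^k\<close> for a directed cycle of length
  \<open>k > 1\<close>.\<close>

lemma avoiding_listings_recursion:
  assumes V: "finite V" "v \<in> V"
    and irr: "\<And>x. x \<in> V \<Longrightarrow> (x, x) \<notin> A"
    and tour: "\<And>x y. x \<in> V \<Longrightarrow> y \<in> V \<Longrightarrow> x \<noteq> y \<Longrightarrow> (x, y) \<in> A \<longleftrightarrow> (y, x) \<notin> A"
  shows "avoiding_listings V A =
    (\<Sum>y \<in> cycle_tails V v. tour_weight A (v # y) * avoiding_listings (V - set (v # y)) A)"
proof -
  \<comment> \<open>The signs are chosen so that \<open>b = 1 + a\<close> is the indicator of the
    non-arcs.\<close>
  define a :: "'a \<Rightarrow> 'a \<Rightarrow> int" where "a = (\<lambda>x y. - of_bool ((x, y) \<in> A))"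
  define b :: "'a \<Rightarrow> 'a \<Rightarrow> int" where "b = (\<lambda>x y. of_bool ((x, y) \<notin> A))"
  let ?C = "\<lambda>y. successively (\<lambda>x y. (x, y) \<in> A) (v # y @ [v])"
  have b_eq: "b = (\<lambda>x y. 1 + a x y)"
    by (auto simp: a_def b_def fun_eq_iff)
  have avoiding: "avoiding_listings W A = listings_weight b W" for W
    unfolding avoiding_listings_def listings_weight_def b_def path_weight_of_bool
    by (simp add: Int_def)
  let ?H = "\<lambda>y. listings_weight b (V - set (v # y))"
  have cyc_a: "path_weight a (v # y @ [v]) = (-1) ^ Suc (length y) * of_bool (?C y)" for y
    by (simp add: a_def path_weight_uminus path_weight_of_bool)
  have cyc_b: "path_weight b (v # rev y @ [v]) = of_bool (y = [] \<or> ?C y)"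
    if y: "y \<in> cycle_tails V v" for y
  proof (cases "y = []")
    case True
    then show ?thesis using irr V by (simp add: b_def)
  next
    case False
    \<comment> \<open>The tournament condition can be used only for distinct vertices; the pair that
      closes the walk needs \<open>y\<close> to be nonempty.\<close>
    have dist: "successively (\<noteq>) (v # y @ [v])"
    proof -
      have "distinct_adj (v # y)"
        using y by (simp only: cycle_tails_def mem_Collect_eq distinct_adj_altdef remdups_adj_distinct)
      moreover have "last (v # y) \<noteq> v"
        using y False by (auto simp: cycle_tails_def)
      ultimately show ?thesis
        using successively_append_iff[of "(\<noteq>)" "v # y" "[v]"] by (simp add: distinct_adj_def)
    qed
    have sub: "set (v # y @ [v]) \<subseteq> V"
      using y V by (auto simp: cycle_tails_def)
    have "path_weight b (v # rev y @ [v]) = of_bool (successively (\<lambda>x y. (x, y) \<notin> A) (rev (v # y @ [v])))"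
      by (simp only: b_def path_weight_of_bool) simp
    also have "\<dots> = of_bool (successively (\<lambda>x y. (y, x) \<notin> A) (v # y @ [v]))"
      by (simp only: successively_rev)
    also have "successively (\<lambda>x y. (y, x) \<notin> A) (v # y @ [v]) \<longleftrightarrow> ?C y"
      using dist sub tour unfolding successively_conv_nth
      by (metis Suc_lessD nth_mem subset_code(1))
    finally show ?thesis using False by simp
  qed
  have "avoiding_listings V A = (\<Sum>y \<in> cycle_tails V v.
      (path_weight b (v # y @ [v]) - path_weight a (v # y @ [v])) * ?H y)"
    unfolding avoiding b_eq by (rule listings_weight_recursion[OF V])
  also have "\<dots> = (\<Sum>y \<in> cycle_tails V v. path_weight b (v # y @ [v]) * ?H y)
      - (\<Sum>y \<in> cycle_tails V v. path_weight a (v # y @ [v]) * ?H y)"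
    by (simp add: left_diff_distrib sum_subtractf)
  \<comment> \<open>Reversal permutes the tails and does not change the set of vertices left
    over.\<close>
  also have "(\<Sum>y \<in> cycle_tails V v. path_weight b (v # y @ [v]) * ?H y)
      = (\<Sum>y \<in> cycle_tails V v. path_weight b (v # rev y @ [v]) * ?H y)"
    by (rule sum.reindex_bij_witness[of _ rev rev]) (auto simp: cycle_tails_def)
  also have "\<dots> - (\<Sum>y \<in> cycle_tails V v. path_weight a (v # y @ [v]) * ?H y)
      = (\<Sum>y \<in> cycle_tails V v. (path_weight b (v # rev y @ [v]) - path_weight a (v # y @ [v])) * ?H y)"
    by (simp add: left_diff_distrib sum_subtractf)
  also have "\<dots> = (\<Sum>y \<in> cycle_tails V v. tour_weight A (v # y) * ?H y)"
    using irr V by (intro sum.cong refl) (auto simp: cyc_a cyc_b tour_weight_def)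
  finally show ?thesis by (simp add: avoiding)
qed

section \<open>Removing a cycle from a permutation\<close>

lemma rot_class_rotate: "rot_class (rotate k xs) = rot_class xs"
proof -
  have sub: "rot_class (rotate k xs) \<subseteq> rot_class xs" for k and xs :: "'a list"
    by (auto simp: rot_class_def rotate_rotate)
  have "rot_class xs \<subseteq> rot_class (rotate k xs)"
  proof (cases "xs = []")
    case False
    then have "k * length xs \<ge> k" by (cases xs) auto
    \<comment> \<open>The two rotations add up to a multiple of the length; the subtraction is exact
      because \<open>xs\<close> is nonempty.\<close>
    then have "rotate (k * length xs - k) (rotate k xs) = xs"
      by (simp add: rotate_rotate rotate_id)
    then show ?thesis
      using sub[of "k * length xs - k" "rotate k xs"] by simp
  qed simp
  with sub show ?thesis by blast
qed

lemma set_mem_rot_class: "ys \<in> rot_class xs \<Longrightarrow> set ys = set xs"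
  by (auto simp: rot_class_def)

text \<open>Powers of \<open>p\<close> commute and \<open>p ^^ k\<close> is injective, so the same
  exponents fix both points.\<close>

lemma least_power_funpow:
  assumes "inj p"
  shows "least_power p ((p ^^ k) x) = least_power p x"
proof -
  have "(p ^^ n) ((p ^^ k) x) = (p ^^ k) x \<longleftrightarrow> (p ^^ n) x = x" for n
  proof -
    have "(p ^^ n) ((p ^^ k) x) = (p ^^ k) ((p ^^ n) x)"
      by (metis add.commute comp_apply funpow_add)
    moreover have "inj (p ^^ k)" using assms by (rule inj_fn)
    ultimately show ?thesis by (simp add: inj_eq)
  qed
  then show ?thesis by (simp add: least_power_def)
qed

text \<open>Starting the cycle at \<open>(p ^^ k) x\<close> instead of \<open>x\<close> rotates its
  tuple by \<open>k\<close>.\<close>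

lemma rot_class_support:
  assumes "permutation p" "y \<in> set (support p x)"
  shows "rot_class (support p y) = rot_class (support p x)"
proof -
  from assms(2) obtain k where y: "y = (p ^^ k) x" by auto
  have lp: "least_power p y = least_power p x"
    unfolding y using assms(1) by (intro least_power_funpow) (simp add: bij_is_inj permutation_bijective)
  have "support p y = rotate k (support p x)"
  proof (rule nth_equalityI)
    fix i assume "i < length (support p y)"
    then have i: "i < least_power p x" by (simp add: lp)
    then have "rotate k (support p x) ! i = (p ^^ ((k + i) mod least_power p x)) x"
      by (simp add: nth_rotate)
    also have "\<dots> = (p ^^ (k + i)) x"
      by (rule funpow_mod_eq) (rule least_power_of_permutation[OF assms(1)])
    also have "\<dots> = (p ^^ i) y"
      by (simp add: y add.commute[of k i] funpow_add)
    also have "\<dots> = support p y ! i"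
      using i by (simp add: lp)
    finally show "support p y ! i = rotate k (support p x) ! i" by simp
  qed (simp add: lp)
  then show ?thesis by (simp add: rot_class_rotate)
qed

lemma funpow_cong_on:
  assumes "\<And>x. x \<in> S \<Longrightarrow> f x = g x" "\<And>x. x \<in> S \<Longrightarrow> g x \<in> S" "x \<in> S"
  shows "(f ^^ n) x = (g ^^ n) x"
proof -
  have "(f ^^ n) x = (g ^^ n) x \<and> (g ^^ n) x \<in> S"
    by (induction n) (use assms in auto)
  then show ?thesis ..
qed

lemma support_cong_on:
  assumes "\<And>x. x \<in> S \<Longrightarrow> f x = g x" "\<And>x. x \<in> S \<Longrightarrow> g x \<in> S" "x \<in> S"
  shows "support f x = support g x"
proof -
  have "(f ^^ n) x = (g ^^ n) x" for n
    using assms by (rule funpow_cong_on)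
  then show ?thesis by (simp add: least_power_def)
qed

text \<open>The powers of the cycle rotate its list, and \<open>v\<close> is the head: the power
  \<open>n\<close> takes \<open>v\<close> to the entry at \<open>n\<close> modulo the length. An
  earlier return to \<open>v\<close> would repeat an entry.\<close>

lemma support_cycle_of_list:
  assumes "distinct (v # y)"
  shows "support (cycle_of_list (v # y)) v = v # y"
proof -
  let ?s = "v # y" and ?c = "cycle_of_list (v # y)"
  have pow: "(?c ^^ n) v = ?s ! (n mod length ?s)" for n
  proof -
    have "(?c ^^ n) v = hd (map (?c ^^ n) ?s)" by simp
    also have "\<dots> = ?s ! (n mod length ?s)"
      unfolding cyclic_rotation[OF assms] by (rule hd_rotate_conv_nth) simp
    finally show ?thesis .
  qed
  have "least_power ?c v = length ?s"
    unfolding least_power_def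
  proof (rule Least_equality)
    fix n assume n: "(?c ^^ n) v = v \<and> 0 < n"
    show "length ?s \<le> n"
    proof (rule ccontr)
      assume "\<not> length ?s \<le> n"
      then have "?s ! n = ?s ! 0" "n < length ?s" using n pow[of n] by auto
      then show False using nth_eq_iff_index_eq[OF assms] n by blast
    qed
  qed (simp only: pow, simp)
  then show ?thesis
    by (intro nth_equalityI) (simp_all add: pow del: cycle_of_list.simps upt_Suc)
qed

lemma support_eq_Cons:
  assumes "permutation p"
  shows "support p v = v # tl (support p v)"
  using least_power_of_permutation(2)[OF assms, of v] by (simp add: upt_conv_Cons)

lemma set_support_subset:
  assumes "p permutes V" "v \<in> V"
  shows "set (support p v) \<subseteq> V"
  using permutes_in_image[OF permutes_funpow[OF assms(1)]] assms(2) by auto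

lemma cycles_eq_image: "cycles V p = (\<lambda>x. rot_class (support p x)) ` V"
  by (auto simp: cycles_def)

text \<open>Off the cycle \<open>s\<close> the map \<open>q\<close> agrees with \<open>p\<close> and
  stays off \<open>s\<close>, so these orbits are unchanged, while all starting points in
  \<open>s\<close> give the same class. That class is new because a rotation class determines its
  vertex set.\<close>

lemma cycles_split:
  assumes V: "finite V" "v \<in> V" and p: "p permutes V"
    and s: "s = support p v" and q: "q = (\<lambda>x. if x \<in> V - set s then p x else x)"
  shows "cycles V p = insert (rot_class s) (cycles (V - set s) q)"
    and "rot_class s \<notin> cycles (V - set s) q"
proof -
  have perm: "permutation p" using V p permutation_permutes by blast
  have qp: "q permutes V - set s"
    unfolding q s by (rule semidecomposition[OF p V(1)])
  have supp: "support q x = support p x" if "x \<in> V - set s" for x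
  proof (rule support_cong_on[symmetric, OF _ _ that])
    show "p x = q x" if "x \<in> V - set s" for x using that by (simp add: q)
    show "q x \<in> V - set s" if "x \<in> V - set s" for x
      using permutes_in_image[OF qp] that by blast
  qed
  have v: "v \<in> set s"
    unfolding s by (subst support_eq_Cons[OF perm]) simp
  have "set s \<subseteq> V" unfolding s by (rule set_support_subset[OF p V(2)])
  then have V_eq: "V = set s \<union> (V - set s)" by blast
  define F where "F = (\<lambda>x. rot_class (support p x))"
  have F_s: "F x = rot_class s" if "x \<in> set s" for x
    using rot_class_support[OF perm] that unfolding F_def s by blast
  have rest: "cycles (V - set s) q = F ` (V - set s)"
    unfolding cycles_eq_image F_def by (intro image_cong refl arg_cong[of _ _ rot_class] supp)
  have "cycles V p = F ` V" unfolding F_def by (rule cycles_eq_image)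
  also have "\<dots> = F ` set s \<union> F ` (V - set s)"
    by (subst V_eq) (rule image_Un)
  also have "F ` set s = {rot_class s}"
    using F_s v by blast
  finally show "cycles V p = insert (rot_class s) (cycles (V - set s) q)"
    by (simp add: rest)
  show "rot_class s \<notin> cycles (V - set s) q"
  proof
    assume "rot_class s \<in> cycles (V - set s) q"
    then obtain x where x: "x \<in> V - set s" "rot_class s = F x"
      unfolding rest by blast
    have "support p x \<in> rot_class s"
      unfolding x(2) F_def by (rule rot_class_self)
    then have "set (support p x) = set s" by (rule set_mem_rot_class)
    moreover have "x \<in> set (support p x)" by (subst support_eq_Cons[OF perm]) simp
    ultimately show False using x by blast
  qed
qed

lemma finite_cycles: "finite V \<Longrightarrow> finite (cycles V p)"
  by (simp add: cycles_def)

text \<open>A permutation is determined by its cycle through \<open>v\<close> and the permutation it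
  induces on the other vertices. Both can be chosen freely, and the product over cycles splits
  accordingly.\<close>

lemma permutations_cycle_recursion:
  fixes g :: "'v list set \<Rightarrow> 'a::comm_ring_1"
  assumes V: "finite V" "v \<in> V"
  shows "(\<Sum>p | p permutes V. \<Prod>\<gamma>\<in>cycles V p. g \<gamma>) =
    (\<Sum>y\<in>cycle_tails V v. g (rot_class (v # y)) *
      (\<Sum>q | q permutes V - set (v # y). \<Prod>\<gamma>\<in>cycles (V - set (v # y)) q. g \<gamma>))"
proof -
  let ?P = "\<lambda>y. {q. q permutes V - set (v # y)}"
  let ?rest = "\<lambda>p x. if x \<in> V - set (support p v) then p x else x"
  have "(\<Sum>p | p permutes V. \<Prod>\<gamma>\<in>cycles V p. g \<gamma>) =
    (\<Sum>(y, q)\<in>Sigma (cycle_tails V v) ?P. g (rot_class (v # y)) * (\<Prod>\<gamma>\<in>cycles (V - set (v # y)) q. g \<gamma>))"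
  proof (rule sum.reindex_bij_witness[of _ "\<lambda>(y, q). cycle_of_list (v # y) \<circ> q"
        "\<lambda>p. (tl (support p v), ?rest p)"])
    fix p assume "p \<in> {p. p permutes V}"
    then have p: "p permutes V" by simp
    then have perm: "permutation p" using V permutation_permutes by blast
    define s where "s = support p v"
    have s: "v # tl s = s" unfolding s_def by (rule support_eq_Cons[OF perm, symmetric])
    have dist: "distinct s" unfolding s_def by (rule cycle_of_permutation[OF perm])
    have sub: "set s \<subseteq> V" unfolding s_def by (rule set_support_subset[OF p V(2)])
    have rest: "?rest p permutes V - set s"
      unfolding s_def by (rule semidecomposition[OF p V(1)])
    \<comment> \<open>On \<open>s\<close> the rest is the identity and the cycle acts as
      \<open>p\<close>; off \<open>s\<close> the image under \<open>p\<close> stays off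
      \<open>s\<close>, where the cycle does nothing.\<close>
    have "(cycle_of_list s \<circ> ?rest p) x = p x" for x
    proof (cases "x \<in> set s")
      case True
      then show ?thesis using cycle_restrict[OF perm, of x v] by (simp add: s_def)
    next
      case False
      then have "?rest p x = p x" using p by (auto simp: s_def permutes_def)
      moreover have "p x \<notin> set s"
      proof (cases "x \<in> V")
        case True
        then show ?thesis using permutes_in_image[OF rest, of x] False by (simp add: s_def)
      next
        case False
        then have "p x = x" using p by (simp add: permutes_def)
        then show ?thesis using \<open>x \<notin> set s\<close> by simp
      qed
      ultimately show ?thesis by (simp add: id_outside_supp)
    qed
    then show "(case (tl (support p v), ?rest p) of (y, q) \<Rightarrow> cycle_of_list (v # y) \<circ> q) = p"
      unfolding case_prod_conv s_def[symmetric] s by (rule ext)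
    show "(tl (support p v), ?rest p) \<in> Sigma (cycle_tails V v) ?P"
    proof -
      have "tl s \<in> cycle_tails V v"
        using dist sub s unfolding cycle_tails_def by (metis (mono_tags) insert_subset list.simps(15) mem_Collect_eq)
      with rest show ?thesis unfolding s_def[symmetric] mem_Sigma_iff s by simp
    qed
    show "(case (tl (support p v), ?rest p) of (y, q) \<Rightarrow>
        g (rot_class (v # y)) * (\<Prod>\<gamma>\<in>cycles (V - set (v # y)) q. g \<gamma>)) = (\<Prod>\<gamma>\<in>cycles V p. g \<gamma>)"
      using cycles_split[OF V p s_def refl] finite_cycles[of "V - set s"] V
      unfolding case_prod_conv s_def[symmetric] s
      by simp
  next
    fix z assume "z \<in> Sigma (cycle_tails V v) ?P"
    then obtain y q where z: "z = (y, q)" and y: "y \<in> cycle_tails V v" and q: "q permutes V - set (v # y)"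
      by auto
    define s where "s = v # y"
    have dist: "distinct s" and sub: "set s \<subseteq> V"
      using y V by (auto simp: s_def cycle_tails_def)
    define p where "p = cycle_of_list s \<circ> q"
    have q: "q permutes V - set s" using q by (simp add: s_def)
    have p: "p permutes V"
      unfolding p_def using q cycle_permutes[of s] sub
      by (metis Diff_subset permutes_compose permutes_subset)
    have ps: "p x = cycle_of_list s x" if "x \<in> set s" for x
      using q that by (simp add: p_def permutes_def)
    have pq: "p x = q x" if "x \<notin> set s" for x
    proof -
      have "q x \<notin> set s"
        using permutes_in_image[OF q, of x] that q by (metis DiffD2 permutes_def DiffI)
      then show ?thesis by (simp add: p_def id_outside_supp)
    qed
    \<comment> \<open>The orbit of \<open>v\<close> never leaves \<open>s\<close>, where
      \<open>q\<close> is the identity.\<close>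
    have supp: "support p v = s"
    proof -
      have "support p v = support (cycle_of_list s) v"
      proof (rule support_cong_on[of "set s"])
        show "cycle_of_list s x \<in> set s" if "x \<in> set s" for x
          using permutes_in_image[OF cycle_permutes[of s]] that by blast
      qed (use ps in \<open>auto simp: s_def\<close>)
      then show ?thesis using support_cycle_of_list dist unfolding s_def by metis
    qed
    have rest: "(\<lambda>x. if x \<in> V - set s then p x else x) = q"
      using pq permutes_not_in[OF q] by (auto simp: fun_eq_iff)
    show "(tl (support (case z of (y, q) \<Rightarrow> cycle_of_list (v # y) \<circ> q) v),
        ?rest (case z of (y, q) \<Rightarrow> cycle_of_list (v # y) \<circ> q)) = z"
      unfolding z case_prod_conv s_def[symmetric] p_def[symmetric] supp rest by (simp add: s_def)
    show "(case z of (y, q) \<Rightarrow> cycle_of_list (v # y) \<circ> q) \<in> {p. p permutes V}"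
      unfolding z case_prod_conv s_def[symmetric] p_def[symmetric] using p by simp
  qed
  also have "\<dots> = (\<Sum>y\<in>cycle_tails V v. g (rot_class (v # y)) *
      (\<Sum>q | q permutes V - set (v # y). \<Prod>\<gamma>\<in>cycles (V - set (v # y)) q. g \<gamma>))"
    unfolding sum_distrib_left
    by (rule sum.Sigma[symmetric]) (use V in \<open>auto simp: finite_cycle_tails finite_permutations\<close>)
  finally show ?thesis .
qed

section \<open>Colourings\<close>

lemma mcoeff_sum: "mcoeff (\<Sum>i\<in>I. g i) m = (\<Sum>i\<in>I. mcoeff (g i) m)"
  by (induction I rule: infinite_finite_induct) (simp_all add: zero_mfps.rep_eq plus_mfps.rep_eq)

lemma mcoeff_of_int_mult: "mcoeff (of_int k * g) m = of_int k * mcoeff g m"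
proof -
  have nat: "mcoeff (of_nat n * g) m = of_nat n * mcoeff g m" for n
    by (induction n) (simp_all add: zero_mfps.rep_eq plus_mfps.rep_eq distrib_right)
  show ?thesis
    by (cases k rule: int_diff_cases) (simp add: left_diff_distrib minus_mfps.rep_eq nat)
qed

lemma mcoeff_fundamental_qsym:
  "mcoeff (fundamental_qsym I n) m = int (card {is \<in> fundamental_tuples I n. mset is = m})"
proof -
  have "mcoeff (fundamental_qsym I n) m =
      (\<Sum>is | is \<in> fundamental_tuples I n \<and> mset is = m. if m = mset is then 1 else 0)"
    unfolding fundamental_qsym_def formal_sum.rep_eq mcoeff_monomial
    by (rule sum.cong) auto
  also have "\<dots> = (\<Sum>is | is \<in> fundamental_tuples I n \<and> mset is = m. 1)"
    by (rule sum.cong) auto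
  finally show ?thesis by simp
qed

text \<open>For a positive exponent different variables have different powers, so no coefficient
  exceeds \<open>1\<close>.\<close>

lemma mcoeff_power_sum:
  assumes "k \<ge> 1"
  shows "mcoeff (power_sum k) m = of_bool (\<exists>c\<ge>1. m = replicate_mset k c)"
proof -
  have inj: "replicate_mset k c = replicate_mset k d \<Longrightarrow> c = d" for c d :: nat
    using assms by (metis in_replicate_mset less_le_trans zero_less_one)
  have "mcoeff (power_sum k) m = (\<Sum>c | c \<ge> 1 \<and> m = replicate_mset k c. 1)"
    unfolding power_sum_def formal_sum.rep_eq mcoeff_mvar_power
    by (rule sum.cong) auto
  also have "\<dots> = of_bool (\<exists>c\<ge>1. m = replicate_mset k c)"
  proof (cases "\<exists>c\<ge>1. m = replicate_mset k c")
    case True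
    then obtain c where "c \<ge> 1" "m = replicate_mset k c" by blast
    then have "{c. c \<ge> 1 \<and> m = replicate_mset k c} = {c}" using inj by auto
    then show ?thesis using True by simp
  next
    case False
    then have "{c. c \<ge> 1 \<and> m = replicate_mset k c} = {}" by blast
    with False show ?thesis by (simp only: sum.empty) simp
  qed
  finally show ?thesis .
qed

text \<open>The summand of \<open>power_sum k\<close> that is used is fixed by its variable
  \<open>c\<close>, and the cofactor is then determined by \<open>m\<close>.\<close>

lemma mcoeff_power_sum_mult:
  assumes "k \<ge> 1"
  shows "mcoeff (power_sum k * g) m =
    (\<Sum>c | c \<ge> 1 \<and> replicate_mset k c \<subseteq># m. mcoeff g (m - replicate_mset k c))"
proof -
  let ?C = "{c. c \<ge> 1 \<and> replicate_mset k c \<subseteq># m}"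
  let ?h = "\<lambda>c. (replicate_mset k c, m - replicate_mset k c)"
  have inj: "inj_on ?h ?C"
    using assms by (intro inj_onI) (metis in_replicate_mset less_le_trans prod.inject zero_less_one)
  have img: "?h ` ?C = {(a, b). a + b = m \<and> (\<exists>c\<ge>1. a = replicate_mset k c)}"
    by (force simp: image_iff)
  have "mcoeff (power_sum k * g) m = (\<Sum>(a, b) | a + b = m. mcoeff (power_sum k) a * mcoeff g b)"
    by (rule times_mfps.rep_eq[THEN fun_cong])
  also have "\<dots> = (\<Sum>(a, b)\<in>?h ` ?C. mcoeff g b)"
    unfolding img by (rule sum.mono_neutral_cong_right)
       (auto simp: finite_mset_splits mcoeff_power_sum[OF assms])
  also have "\<dots> = (\<Sum>c\<in>?C. mcoeff g (m - replicate_mset k c))"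
    by (subst sum.reindex[OF inj]) simp
  finally show ?thesis .
qed

section \<open>Listings with admissible tuples as colourings\<close>

definition colourings :: "'v set \<Rightarrow> nat multiset \<Rightarrow> ('v \<Rightarrow> nat) set" where
  "colourings V m = {f \<in> V \<rightarrow>\<^sub>E {1..}. image_mset f (mset_set V) = m}"

text \<open>The arcs are the forbidden consecutive pairs: the colour must not drop, and it must rise
  strictly along an arc of \<open>A\<close>.\<close>

definition colour_arcs :: "('v \<times> 'v) set \<Rightarrow> ('v \<Rightarrow> nat) \<Rightarrow> ('v \<times> 'v) set" where
  "colour_arcs A f = {(x, y). f y < f x \<or> f x = f y \<and> (x, y) \<in> A}"

lemma finite_colourings:
  assumes "finite V"
  shows "finite (colourings V m)"
proof (rule finite_subset)
  show "colourings V m \<subseteq> V \<rightarrow>\<^sub>E set_mset m"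
    using assms by (auto simp: colourings_def PiE_iff extensional_def)
qed (use assms in \<open>simp add: finite_PiE\<close>)

lemma map_mem_fundamental_tuples_iff:
  assumes "w \<in> permutations_of_set V" "f ` V \<subseteq> {1..}"
  shows "map f w \<in> fundamental_tuples (Des w A) (card V) \<longleftrightarrow>
    successively (\<lambda>x y. (x, y) \<notin> colour_arcs A f) w"
proof -
  have w: "set w = V" "distinct w" "length w = card V"
    using assms(1) by (auto simp: permutations_of_set_def distinct_card)
  \<comment> \<open>Descents count from 1 and list positions from 0, so the descent \<open>p\<close>
    belongs to the pair starting at position \<open>p - 1\<close>.\<close>
  have "(\<forall>p \<in> Des w A. map f w ! (p - 1) < map f w ! p) \<longleftrightarrow>
      (\<forall>i. Suc i < length w \<longrightarrow> (w ! i, w ! Suc i) \<in> A \<longrightarrow> f (w ! i) < f (w ! Suc i))"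
  proof (intro iffI ballI allI impI)
    fix p assume *: "\<forall>i. Suc i < length w \<longrightarrow> (w ! i, w ! Suc i) \<in> A \<longrightarrow> f (w ! i) < f (w ! Suc i)"
      and p: "p \<in> Des w A"
    from p have "p \<noteq> 0" "p < length w" "(w ! (p - 1), w ! p) \<in> A" by (auto simp: Des_def)
    with *[rule_format, of "p - 1"] show "map f w ! (p - 1) < map f w ! p" by simp
  next
    fix i assume *: "\<forall>p \<in> Des w A. map f w ! (p - 1) < map f w ! p"
      and i: "Suc i < length w" "(w ! i, w ! Suc i) \<in> A"
    then have "Suc i \<in> Des w A" by (auto simp: Des_def)
    with *[rule_format, of "Suc i"] i show "f (w ! i) < f (w ! Suc i)" by simp
  qed
  moreover have "\<forall>i \<in> set (map f w). i \<ge> 1" using assms(2) w by auto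
  ultimately have "map f w \<in> fundamental_tuples (Des w A) (card V) \<longleftrightarrow> sorted (map f w) \<and>
      (\<forall>i. Suc i < length w \<longrightarrow> (w ! i, w ! Suc i) \<in> A \<longrightarrow> f (w ! i) < f (w ! Suc i))"
    using w by (simp add: fundamental_tuples_def)
  also have "\<dots> \<longleftrightarrow> successively (\<lambda>x y. (x, y) \<notin> colour_arcs A f) w"
    by (auto simp: sorted_iff_nth_Suc successively_conv_nth colour_arcs_def not_less order.order_iff_strict)
  finally show ?thesis .
qed

text \<open>As \<open>w\<close> lists \<open>V\<close> without repetition and colourings are
  extensional, reading the colours along \<open>w\<close> is a bijection onto the tuples.\<close>

lemma card_fundamental_tuples_eq:
  assumes "w \<in> permutations_of_set V"
  shows "card {is \<in> fundamental_tuples (Des w A) (card V). mset is = m} =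
    card {f \<in> colourings V m. successively (\<lambda>x y. (x, y) \<notin> colour_arcs A f) w}"
proof (rule sym, rule bij_betw_same_card[of "\<lambda>f. map f w"])
  have w: "set w = V" "distinct w" "length w = card V"
    using assms(1) by (auto simp: permutations_of_set_def distinct_card)
  have mset_w: "mset_set V = mset w"
    using w by (metis mset_set_set)
  let ?F = "{f \<in> colourings V m. successively (\<lambda>x y. (x, y) \<notin> colour_arcs A f) w}"
  show "bij_betw (\<lambda>f. map f w) ?F {is \<in> fundamental_tuples (Des w A) (card V). mset is = m}"
  proof (rule bij_betw_imageI)
    show "inj_on (\<lambda>f. map f w) ?F"
      using w by (auto simp: inj_on_def colourings_def intro: PiE_ext)
    show "(\<lambda>f. map f w) ` ?F = {is \<in> fundamental_tuples (Des w A) (card V). mset is = m}"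
    proof (intro equalityI subsetI)
      fix xs assume "xs \<in> (\<lambda>f. map f w) ` ?F"
      then obtain f where f: "f \<in> ?F" "xs = map f w" by blast
      then have "f ` V \<subseteq> {1..}" by (auto simp: colourings_def)
      from map_mem_fundamental_tuples_iff[OF assms this] f
      show "xs \<in> {is \<in> fundamental_tuples (Des w A) (card V). mset is = m}"
        by (auto simp: colourings_def mset_w)
    next
      fix xs assume xs: "xs \<in> {is \<in> fundamental_tuples (Des w A) (card V). mset is = m}"
      then have len: "length xs = length w" and pos: "set xs \<subseteq> {1..}"
        by (auto simp: fundamental_tuples_def w)
      \<comment> \<open>The inverse map: the vertex \<open>w ! i\<close> gets the colour
        \<open>xs ! i\<close>.\<close>
      define f where "f = restrict (the \<circ> map_of (zip w xs)) V"
      have map: "map f w = xs"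
      proof (rule nth_equalityI)
        fix i assume "i < length (map f w)"
        then have i: "i < length w" by simp
        then have "w ! i \<in> V" using w nth_mem by blast
        with i show "map f w ! i = xs ! i" using len w by (simp add: f_def map_of_zip_nth)
      qed (simp add: len)
      then have im: "f ` V \<subseteq> {1..}" using pos w by (metis list.set_map)
      have "f \<in> colourings V m"
        using im xs map by (auto simp: colourings_def mset_w PiE_iff f_def simp flip: mset_map)
      with map_mem_fundamental_tuples_iff[OF assms im] xs map
      show "xs \<in> (\<lambda>f. map f w) ` ?F" by (auto simp: image_iff)
    qed
  qed
qed

text \<open>Pairs of a listing and a compatible colouring are counted in the two orders.\<close>

lemma mcoeff_redei_berge:
  assumes "finite V"
  shows "mcoeff (redei_berge V A) m = (\<Sum>f\<in>colourings V m. avoiding_listings V (colour_arcs A f))"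
proof -
  let ?Q = "\<lambda>f w. successively (\<lambda>x y. (x, y) \<notin> colour_arcs A f) w"
  have "mcoeff (redei_berge V A) m =
      (\<Sum>w\<in>permutations_of_set V. int (card {f \<in> colourings V m. ?Q f w}))"
    unfolding redei_berge_def mcoeff_sum mcoeff_fundamental_qsym
    by (intro sum.cong refl arg_cong[of _ _ int] card_fundamental_tuples_eq)
  also have "\<dots> = (\<Sum>w\<in>permutations_of_set V. \<Sum>f\<in>colourings V m. of_bool (?Q f w))"
    by (simp add: finite_colourings[OF assms] Int_def)
  also have "\<dots> = (\<Sum>f\<in>colourings V m. \<Sum>w\<in>permutations_of_set V. of_bool (?Q f w))"
    by (rule sum.swap)
  also have "\<dots> = (\<Sum>f\<in>colourings V m. avoiding_listings V (colour_arcs A f))"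
    by (simp add: avoiding_listings_def Int_def)
  finally show ?thesis .
qed

lemma avoiding_listings_colour_arcs_cong:
  assumes "\<And>x. x \<in> W \<Longrightarrow> f x = g x"
  shows "avoiding_listings W (colour_arcs A f) = avoiding_listings W (colour_arcs A g)"
proof -
  have "successively (\<lambda>x y. (x, y) \<notin> colour_arcs A f) w \<longleftrightarrow>
      successively (\<lambda>x y. (x, y) \<notin> colour_arcs A g) w" if "w \<in> permutations_of_set W" for w
    using that assms by (intro successively_cong refl) (auto simp: colour_arcs_def permutations_of_set_def)
  then show ?thesis unfolding avoiding_listings_def by (metis (no_types, lifting))
qed

text \<open>Colours weakly decrease along \<open>colour_arcs A f\<close>, so on a closed walk they
  are constant; at constant colour these arcs are those of \<open>A\<close>.\<close>

lemma tour_weight_colour_arcs: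
  "tour_weight (colour_arcs A f) (v # y) =
    (if \<forall>x\<in>set y. f x = f v then tour_weight A (v # y) else 0)"
proof -
  have "successively (\<lambda>x y. (x, y) \<in> colour_arcs A f) (v # y @ [v]) \<longleftrightarrow>
      (\<forall>x\<in>set y. f x = f v) \<and> successively (\<lambda>x y. (x, y) \<in> A) (v # y @ [v])" (is "?L \<longleftrightarrow> ?R")
  proof
    assume L: ?L
    then have "successively (\<lambda>x y. f x \<ge> f y) (v # y @ [v])"
      by (rule successively_mono) (auto simp: colour_arcs_def)
    \<comment> \<open>By transitivity each vertex of \<open>y\<close> is compared with both
      occurrences of \<open>v\<close>, which bounds its colour from both sides.\<close>
    then have "sorted_wrt (\<lambda>x y. f x \<ge> f y) (v # y @ [v])"
      by (subst (asm) successively_conv_sorted_wrt) (auto simp: transp_def)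
    then have const: "\<forall>x\<in>set y. f x = f v"
      by (auto simp: sorted_wrt_append intro: order.antisym)
    have "successively (\<lambda>x y. (x, y) \<in> A) (v # y @ [v])"
      using L by (rule successively_mono) (use const in \<open>auto simp: colour_arcs_def\<close>)
    with const show ?R by simp
  next
    assume R: ?R
    then have "successively (\<lambda>x y. (x, y) \<in> A) (v # y @ [v])" by blast
    then show ?L
      by (rule successively_mono) (use R in \<open>auto simp: colour_arcs_def\<close>)
  qed
  then show ?thesis by (auto simp: tour_weight_def)
qed

text \<open>Such a colouring consists of a common colour \<open>c\<close> on \<open>S\<close>, which
  uses up \<open>card S\<close> copies of \<open>c\<close> in \<open>m\<close>, and any colouring of
  \<open>V - S\<close> with the remaining monomial.\<close>

lemma sum_colourings_constant_on:
  assumes V: "finite V" and S: "S \<subseteq> V" "v \<in> S"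
  shows "(\<Sum>f | f \<in> colourings V m \<and> (\<forall>x\<in>S. f x = f v). h (restrict f (V - S))) =
    (\<Sum>c | c \<ge> 1 \<and> replicate_mset (card S) c \<subseteq># m.
      \<Sum>f\<in>colourings (V - S) (m - replicate_mset (card S) c). h f)"
proof -
  let ?k = "card S"
  let ?C = "{c. c \<ge> 1 \<and> replicate_mset ?k c \<subseteq># m}"
  have fin_S: "finite S" using V S finite_subset by blast
  then have k: "?k > 0" using S by (auto simp: card_gt_0_iff)
  have split: "image_mset f (mset_set V) = image_mset f (mset_set S) + image_mset f (mset_set (V - S))"
    for f :: "'a \<Rightarrow> nat"
    using V S fin_S mset_set_Union[of S "V - S"] by (simp add: Un_absorb1 Diff_partition)
  have const: "image_mset f (mset_set S) = replicate_mset ?k c" if "\<forall>x\<in>S. f x = c" for f and c :: nat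
  proof -
    have "image_mset f (mset_set S) = image_mset (\<lambda>_. c) (mset_set S)"
      using that fin_S by (intro image_mset_cong) simp
    then show ?thesis by (simp add: image_mset_const_eq)
  qed
  have "finite ?C"
    by (rule finite_subset[of _ "set_mset m"]) (use k in \<open>auto dest: mset_subset_eqD\<close>)
  have "(\<Sum>f | f \<in> colourings V m \<and> (\<forall>x\<in>S. f x = f v). h (restrict f (V - S))) =
      (\<Sum>(c, f)\<in>Sigma ?C (\<lambda>c. colourings (V - S) (m - replicate_mset ?k c)). h f)"
  proof (rule sum.reindex_bij_witness[of _ "\<lambda>(c, f) x. if x \<in> S then c else f x"
        "\<lambda>f. (f v, restrict f (V - S))"])
    fix f assume "f \<in> {f. f \<in> colourings V m \<and> (\<forall>x\<in>S. f x = f v)}"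
    then have f: "f \<in> V \<rightarrow>\<^sub>E {1..}" "image_mset f (mset_set V) = m" "\<forall>x\<in>S. f x = f v"
      by (auto simp: colourings_def)
    show "(case (f v, restrict f (V - S)) of (c, f) \<Rightarrow> \<lambda>x. if x \<in> S then c else f x) = f"
    proof
      fix x
      have "f v = f x" if "x \<in> S" using f(3) that by metis
      moreover have "f x = undefined" if "x \<notin> V" using PiE_arb[OF f(1) that] .
      ultimately show "(case (f v, restrict f (V - S)) of (c, f) \<Rightarrow> \<lambda>x. if x \<in> S then c else f x) x = f x"
        by simp
    qed
    have m: "m = replicate_mset ?k (f v) + image_mset f (mset_set (V - S))"
      using f(2) split[of f] const[OF f(3)] by simp
    have "image_mset (restrict f (V - S)) (mset_set (V - S)) = image_mset f (mset_set (V - S))"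
      using V by (intro image_mset_cong) simp
    moreover have "f v \<ge> 1" using f(1) S by (auto simp: PiE_iff)
    ultimately show "(f v, restrict f (V - S)) \<in> Sigma ?C (\<lambda>c. colourings (V - S) (m - replicate_mset ?k c))"
      using m f(1) by (auto simp: colourings_def PiE_iff)
  next
    fix z assume "z \<in> Sigma ?C (\<lambda>c. colourings (V - S) (m - replicate_mset ?k c))"
    then obtain c f where z: "z = (c, f)" and c: "c \<ge> 1" "replicate_mset ?k c \<subseteq># m"
      and f: "f \<in> V - S \<rightarrow>\<^sub>E {1..}" "image_mset f (mset_set (V - S)) = m - replicate_mset ?k c"
      by (auto simp: colourings_def)
    let ?g = "\<lambda>x. if x \<in> S then c else f x"
    have "restrict ?g (V - S) = f"
      using f(1) by (auto simp: fun_eq_iff PiE_iff extensional_def)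
    then show "((case z of (c, f) \<Rightarrow> \<lambda>x. if x \<in> S then c else f x) v,
        restrict (case z of (c, f) \<Rightarrow> \<lambda>x. if x \<in> S then c else f x) (V - S)) = z"
      using S z by simp
    have "image_mset ?g (mset_set (V - S)) = image_mset f (mset_set (V - S))"
      using V by (intro image_mset_cong) simp
    then have "image_mset ?g (mset_set V) = m"
      using split[of ?g] const[of ?g c] f(2) c(2) by simp
    moreover have "?g \<in> V \<rightarrow>\<^sub>E {1..}"
      using f(1) c(1) S by (auto simp: PiE_iff extensional_def)
    ultimately show "(case z of (c, f) \<Rightarrow> \<lambda>x. if x \<in> S then c else f x)
        \<in> {f. f \<in> colourings V m \<and> (\<forall>x\<in>S. f x = f v)}"
      using z S by (simp add: colourings_def)
  qed simp
  also have "\<dots> = (\<Sum>c\<in>?C. \<Sum>f\<in>colourings (V - S) (m - replicate_mset ?k c). h f)"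
    by (rule sum.Sigma[symmetric]) (use \<open>finite ?C\<close> V in \<open>auto simp: finite_colourings\<close>)
  finally show ?thesis .
qed

text \<open>For each colouring the cycle through \<open>v\<close> is removed from its tournament of
  colour arcs. Only colourings constant on the cycle survive, and summing over the common colour
  produces the power sum.\<close>

lemma redei_berge_recursion:
  assumes V: "finite V" "v \<in> V"
    and irr: "\<And>x. x \<in> V \<Longrightarrow> (x, x) \<notin> A"
    and tour: "\<And>x y. x \<in> V \<Longrightarrow> y \<in> V \<Longrightarrow> x \<noteq> y \<Longrightarrow> (x, y) \<in> A \<longleftrightarrow> (y, x) \<notin> A"
  shows "redei_berge V A = (\<Sum>y\<in>cycle_tails V v.
    of_int (tour_weight A (v # y)) * power_sum (length (v # y)) * redei_berge (V - set (v # y)) A)"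
proof (rule mfps_eqI)
  fix m
  let ?H = "\<lambda>y f. avoiding_listings (V - set (v # y)) (colour_arcs A f)"
  let ?const = "\<lambda>y f. \<forall>x\<in>set (v # y). f x = f v"
  have rec: "avoiding_listings V (colour_arcs A f) =
      (\<Sum>y\<in>cycle_tails V v. tour_weight (colour_arcs A f) (v # y) * ?H y f)" for f
  proof (rule avoiding_listings_recursion[OF V])
    show "(x, x) \<notin> colour_arcs A f" if "x \<in> V" for x
      using irr[OF that] by (simp add: colour_arcs_def)
    \<comment> \<open>Different colours decide the direction by themselves; equal colours leave it
      to \<open>A\<close>.\<close>
    show "(x, y) \<in> colour_arcs A f \<longleftrightarrow> (y, x) \<notin> colour_arcs A f"
      if "x \<in> V" "y \<in> V" "x \<noteq> y" for x y
      using tour[OF that] unfolding colour_arcs_def mem_Collect_eq case_prod_conv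
      by (metis less_asym linorder_less_linear)
  qed
  have "mcoeff (redei_berge V A) m =
      (\<Sum>f\<in>colourings V m. \<Sum>y\<in>cycle_tails V v. tour_weight (colour_arcs A f) (v # y) * ?H y f)"
    by (simp only: mcoeff_redei_berge[OF V(1)] rec)
  also have "\<dots> = (\<Sum>y\<in>cycle_tails V v. \<Sum>f\<in>colourings V m. tour_weight (colour_arcs A f) (v # y) * ?H y f)"
    by (rule sum.swap)
  also have "\<dots> = (\<Sum>y\<in>cycle_tails V v. tour_weight A (v # y) *
      mcoeff (power_sum (length (v # y)) * redei_berge (V - set (v # y)) A) m)"
  proof (rule sum.cong[OF refl])
    fix y assume y: "y \<in> cycle_tails V v"
    have S: "set (v # y) \<subseteq> V" "v \<in> set (v # y)" "card (set (v # y)) = length (v # y)"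
      using y V distinct_card[of "v # y"] by (auto simp: cycle_tails_def)
    have "(\<Sum>f\<in>colourings V m. tour_weight (colour_arcs A f) (v # y) * ?H y f) =
        (\<Sum>f | f \<in> colourings V m \<and> ?const y f. tour_weight A (v # y) * ?H y f)"
      by (rule sum.mono_neutral_cong_right)
         (auto simp: finite_colourings[OF V(1)] tour_weight_colour_arcs)
    \<comment> \<open>The inner count sees only the colours off the cycle, so the colouring may be
      restricted to them.\<close>
    also have "\<dots> = tour_weight A (v # y) *
        (\<Sum>f | f \<in> colourings V m \<and> ?const y f. ?H y (restrict f (V - set (v # y))))"
      unfolding sum_distrib_left
      by (intro sum.cong refl arg_cong2[of _ _ _ _ "(*)"] avoiding_listings_colour_arcs_cong) simp
    also have "(\<Sum>f | f \<in> colourings V m \<and> ?const y f. ?H y (restrict f (V - set (v # y)))) =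
        (\<Sum>c | c \<ge> 1 \<and> replicate_mset (length (v # y)) c \<subseteq># m.
          \<Sum>f\<in>colourings (V - set (v # y)) (m - replicate_mset (length (v # y)) c). ?H y f)"
      using sum_colourings_constant_on[OF V(1) S(1,2), of "?H y" m] unfolding S(3) .
    also have "\<dots> = mcoeff (power_sum (length (v # y)) * redei_berge (V - set (v # y)) A) m"
      using V by (subst mcoeff_power_sum_mult) (simp_all add: mcoeff_redei_berge)
    finally show "(\<Sum>f\<in>colourings V m. tour_weight (colour_arcs A f) (v # y) * ?H y f) =
        tour_weight A (v # y) * mcoeff (power_sum (length (v # y)) * redei_berge (V - set (v # y)) A) m" .
  qed
  also have "\<dots> = mcoeff (\<Sum>y\<in>cycle_tails V v.
      of_int (tour_weight A (v # y)) * power_sum (length (v # y)) * redei_berge (V - set (v # y)) A) m"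
    by (simp add: mcoeff_sum mult.assoc mcoeff_of_int_mult)
  finally show "mcoeff (redei_berge V A) m = \<dots>" .
qed

section \<open>Tournaments\<close>

text \<open>For \<open>u = v\<close> the second zipped list is \<open>rotate1 (v # y)\<close>, which
  links closed walks to \<open>CArcs\<close>.\<close>

lemma successively_closed_iff_zip:
  "successively P (v # y @ [u]) \<longleftrightarrow> (\<forall>(a, b)\<in>set (zip (v # y) (y @ [u])). P a b)"
  by (induction y arbitrary: v) auto

text \<open>The recursion for permutations needs a function of the rotation class, so
  \<open>tour_weight\<close> is restated for classes and joined with the power sum.\<close>

definition tour_cycle_term :: "('v \<times> 'v) set \<Rightarrow> 'v list set \<Rightarrow> int mfps" where
  "tour_cycle_term A \<gamma> = (if cycle_length \<gamma> = 1 then 1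
     else if odd (cycle_length \<gamma>) \<and> CArcs \<gamma> \<subseteq> A then 2 else 0) * power_sum (cycle_length \<gamma>)"

lemma tour_cycle_term_rot_class:
  "tour_cycle_term A (rot_class (v # y)) =
    of_int (tour_weight A (v # y)) * power_sum (length (v # y))"
proof -
  have "CArcs (rot_class (v # y)) \<subseteq> A \<longleftrightarrow> successively (\<lambda>x y. (x, y) \<in> A) (v # y @ [v])"
    unfolding successively_closed_iff_zip CArcs_rot_class by auto
  then show ?thesis by (simp add: tour_cycle_term_def tour_weight_def)
qed

lemma redei_berge_empty: "redei_berge {} A = 1"
proof (rule mfps_eqI)
  fix m
  have "avoiding_listings {} B = 1" for B :: "('a \<times> 'a) set"
  proof -
    have "{w \<in> permutations_of_set ({} :: 'a set). successively (\<lambda>x y. (x, y) \<notin> B) w} = {[]}"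
      by auto
    then show ?thesis by (simp add: avoiding_listings_def)
  qed
  moreover have "colourings ({} :: 'a set) m = (if m = {#} then {\<lambda>_. undefined} else {})"
    by (auto simp: colourings_def)
  ultimately show "mcoeff (redei_berge {} A) m = mcoeff 1 m"
    by (simp add: mcoeff_redei_berge one_mfps.rep_eq)
qed

text \<open>Both sides obey the same recursion removing the cycle through a vertex. The hypotheses
  speak only of pairs in \<open>V\<close>, so they pass to subsets while \<open>A\<close> stays
  fixed.\<close>

lemma redei_berge_eq_sum_permutations:
  assumes "finite V"
    and "\<And>x. x \<in> V \<Longrightarrow> (x, x) \<notin> A"
    and "\<And>x y. x \<in> V \<Longrightarrow> y \<in> V \<Longrightarrow> x \<noteq> y \<Longrightarrow> (x, y) \<in> A \<longleftrightarrow> (y, x) \<notin> A"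
  shows "redei_berge V A = (\<Sum>p | p permutes V. \<Prod>\<gamma>\<in>cycles V p. tour_cycle_term A \<gamma>)"
  using assms
proof (induction V rule: finite_psubset_induct)
  case (psubset V)
  show ?case
  proof (cases "V = {}")
    case True
    then show ?thesis by (simp add: redei_berge_empty cycles_def)
  next
    case False
    then obtain v where v: "v \<in> V" by blast
    have IH: "redei_berge (V - set (v # y)) A =
        (\<Sum>p | p permutes V - set (v # y). \<Prod>\<gamma>\<in>cycles (V - set (v # y)) p. tour_cycle_term A \<gamma>)" for y
    proof (rule psubset.IH)
      show "V - set (v # y) \<subset> V" using v by auto
    qed (use psubset.prems in blast)+
    show ?thesis
      unfolding permutations_cycle_recursion[OF psubset.hyps v] tour_cycle_term_rot_class IH[symmetric]
      by (rule redei_berge_recursion[OF psubset.hyps v psubset.prems])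
  qed
qed

section \<open>From products over cycles to the permutations in \<open>D_perms\<close>\<close>

lemma cycles_mem_D_cycles_iff:
  assumes "finite V" "p permutes V" "\<gamma> \<in> cycles V p"
  shows "\<gamma> \<in> D_cycles V A \<longleftrightarrow> CArcs \<gamma> \<subseteq> A"
proof -
  have perm: "permutation p" using assms permutation_permutes by blast
  from assms(3) obtain x where x: "x \<in> V" "\<gamma> = rot_class (support p x)"
    by (auto simp: cycles_def)
  \<comment> \<open>A cycle of a permutation is nonempty, free of repetitions and inside
    \<open>V\<close>, which leaves the arc condition.\<close>
  have "support p x \<noteq> []" by (subst support_eq_Cons[OF perm]) simp
  moreover have "distinct (support p x)" by (rule cycle_of_permutation[OF perm])
  moreover have "set (support p x) \<subseteq> V" by (rule set_support_subset[OF assms(2) x(1)])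
  ultimately have "CArcs \<gamma> \<subseteq> A \<Longrightarrow> \<gamma> \<in> D_cycles V A"
    unfolding D_cycles_def x(2) by blast
  then show ?thesis by (auto simp: D_cycles_def)
qed

lemma cycle_length_pos:
  assumes "finite V" "p permutes V" "\<gamma> \<in> cycles V p"
  shows "cycle_length \<gamma> > 0"
proof -
  have "permutation p" using assms permutation_permutes by blast
  with assms(3) show ?thesis
    by (auto simp: cycles_def least_power_of_permutation)
qed

text \<open>One even cycle, or one nontrivial cycle that is not a \<open>D\<close>-cycle,
  contributes a factor \<open>0\<close>. Otherwise each nontrivial cycle contributes a
  \<open>2\<close>, and the power sums multiply to that of the cycle type.\<close>

lemma prod_tour_cycle_term:
  assumes V: "finite V" and p: "p permutes V"
  shows "(\<Prod>\<gamma>\<in>cycles V p. tour_cycle_term A \<gamma>) =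
    (if p \<in> D_perms V A \<and> (\<forall>\<gamma>\<in>cycles V p. odd (cycle_length \<gamma>))
     then 2 ^ card (nontrivial_cycles V p) * power_sum_partition (cycle_type V p) else 0)"
proof -
  have fin: "finite (cycles V p)" using V by (rule finite_cycles)
  have D: "p \<in> D_perms V A \<longleftrightarrow> (\<forall>\<gamma>\<in>cycles V p. cycle_length \<gamma> > 1 \<longrightarrow> CArcs \<gamma> \<subseteq> A)"
    using p cycles_mem_D_cycles_iff[OF V p] by (auto simp: D_perms_def nontrivial_cycles_def)
  show ?thesis
  proof (cases "p \<in> D_perms V A \<and> (\<forall>\<gamma>\<in>cycles V p. odd (cycle_length \<gamma>))")
    case True
    have "tour_cycle_term A \<gamma> = (if cycle_length \<gamma> > 1 then 2 else 1) * power_sum (cycle_length \<gamma>)"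
      if "\<gamma> \<in> cycles V p" for \<gamma>
      using True that cycle_length_pos[OF V p that] unfolding D by (auto simp: tour_cycle_term_def)
    then have "(\<Prod>\<gamma>\<in>cycles V p. tour_cycle_term A \<gamma>) =
        (\<Prod>\<gamma>\<in>cycles V p. if cycle_length \<gamma> > 1 then 2 else 1) * (\<Prod>\<gamma>\<in>cycles V p. power_sum (cycle_length \<gamma>))"
      by (simp add: prod.distrib)
    also have "(\<Prod>\<gamma>\<in>cycles V p. if cycle_length \<gamma> > 1 then 2 else 1) = (2 :: int mfps) ^ card (nontrivial_cycles V p)"
      using fin by (simp add: nontrivial_cycles_def flip: prod.inter_filter)
    also have "(\<Prod>\<gamma>\<in>cycles V p. power_sum (cycle_length \<gamma>)) = power_sum_partition (cycle_type V p)"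
      by (simp add: power_sum_partition_def cycle_type_def prod_unfold_prod_mset multiset.map_comp comp_def)
    finally show ?thesis using True by simp
  next
    case False
    then obtain \<gamma> where "\<gamma> \<in> cycles V p" "even (cycle_length \<gamma>) \<or> cycle_length \<gamma> > 1 \<and> \<not> CArcs \<gamma> \<subseteq> A"
      unfolding D by blast
    then have "\<exists>\<gamma>\<in>cycles V p. tour_cycle_term A \<gamma> = 0"
      by (intro bexI[of _ \<gamma>]) (auto simp: tour_cycle_term_def)
    then have "(\<Prod>\<gamma>\<in>cycles V p. tour_cycle_term A \<gamma>) = 0"
      using fin by (intro prod_zero)
    then show ?thesis unfolding if_not_P[OF False] .
  qed
qed

theorem theorem1p39:
  fixes V :: "'v set" and A :: "('v \<times> 'v) set"
  assumes "tournament V A"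
  shows "redei_berge V A =
    (\<Sum>\<sigma> | \<sigma> \<in> D_perms V A \<and> (\<forall>\<gamma> \<in> cycles V \<sigma>. odd (cycle_length \<gamma>)).
      2 ^ card (nontrivial_cycles V \<sigma>) * power_sum_partition (cycle_type V \<sigma>))"
proof -
  have V: "finite V" using assms by (simp add: tournament_def)
  have "redei_berge V A = (\<Sum>p | p permutes V. \<Prod>\<gamma>\<in>cycles V p. tour_cycle_term A \<gamma>)"
    using assms by (intro redei_berge_eq_sum_permutations) (auto simp: tournament_def)
  also have "\<dots> = (\<Sum>\<sigma> | \<sigma> \<in> D_perms V A \<and> (\<forall>\<gamma> \<in> cycles V \<sigma>. odd (cycle_length \<gamma>)).
      2 ^ card (nontrivial_cycles V \<sigma>) * power_sum_partition (cycle_type V \<sigma>))"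
    \<comment> \<open>The permutations left out on the right are those whose product
      vanishes.\<close>
    by (rule sum.mono_neutral_cong_right)
       (auto simp: V finite_permutations prod_tour_cycle_term D_perms_def)
  finally show ?thesis .
qed

end
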